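(* Let $d,N\ge 1$ be integers, let $0<r\le 1$, and let $U:\mathbb{Z}^+\to\mathbb{R}^{d\times d}$. Let $Z:\mathbb{Z}^+\to\mathbb{R}^{d\times d}$ be the sequence satisfying $$Z(n+1)=\sum_{j=0}^{n}U(n-j)Z(j),\quad n\in\mathbb{Z}^+,\qquad Z(0)=I.$$ Suppose that $Z\in\mathcal{WP}(r,N)$ with weight function $\phi\in\mathcal{W}(r)$, i.e. there exist matrices $\rho_0,\dots,\rho_{N-1}\in\mathbb{R}^{d\times d}$ such that $$\lim_{n\to\infty}\frac{1}{\phi(Nn)}Z(Nn+i)=\rho_i,\qquad i\in\{0,1,\dots,N-1\},$$ and suppose that $$\max_{1\le p\le d}\left(\sum_{q=1}^{d}\sum_{i=0}^{N-1}\sum_{l=0}^{\infty}r^{-N(l+1)}|U(Nl+i)|_{p,q}\right)<\frac{1}{1+r^{-N}}.$$ Then $U\in\mathcal{WP}(r,N)$ with weight function $\phi$, i.e. there exist matrices $A_0,\dots,A_{N-1}\in\mathbb{R}^{d\times d}$ such that $$\lim_{n\to\infty}\frac{1}{\phi(Nn)}U(Nn+i)=A_i,\qquad i\in\{0,1,\dots,N-1\}.$$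
   Context: $\mathbb{Z}^+=\{n\in\mathbb{Z}:n\ge 0\}$; $I$ is the $d\times d$ identity matrix. For a matrix $A$, $|A|$ is the matrix of absolute values of its entries, and $|A|_{p,q}$ its $(p,q)$ entry. For $r>0$, a real sequence $\gamma=\{\gamma(n)\}_{n\ge 0}$ is in $\mathcal{W}(r)$ if $\gamma(n)>0$ for all $n\ge 0$, $$\lim_{n\to\infty}\frac{\gamma(n-1)}{\gamma(n)}=\frac1r,\qquad \sum_{i=0}^{\infty}\gamma(i)r^{-i}<\infty,\qquad \lim_{m\to\infty}\left(\limsup_{n\to\infty}\frac{1}{\gamma(n)}\sum_{i=m}^{n-m}\gamma(n-i)\gamma(i)\right)=0.$$ For integers $d,N\ge1$ and finite $r>0$, a sequence $U=\{U(n)\}_{n\ge0}$ in $\mathbb{R}^{d\times d}$ is in $\mathcal{WP}(r,N)$ if there exist $\phi\in\mathcal{W}(r)$ and $d\times d$ matrices $\{A_i\}_{i=0}^{N-1}$ such that $\lim_{n\to\infty}U(Nn+i)/\phi(Nn)=A_i$ for each $i\in\{0,\dots,N-1\}$; $\phi$ is then called a weight function for $U$. *)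

theory Defs
  imports "HOL-Analysis.Analysis"
begin

text \<open>
  The upper limit is taken in the extended reals, where it always exists; the outer limit
  being \<open>0\<close> therefore includes that it is finite for all large \<open>m\<close>.  Truncated
  subtraction is harmless: \<open>n - 1\<close> matters only for large \<open>n\<close>, and for \<open>n < m\<close> the range
  \<open>{m..n - m}\<close> is empty, as intended.
\<close>

definition W_class :: "real \<Rightarrow> (nat \<Rightarrow> real) set" where
  "W_class r = {\<gamma>.
     (\<forall>n. \<gamma> n > 0) \<and>
     (\<lambda>n. \<gamma> (n - 1) / \<gamma> n) \<longlonglongrightarrow> 1 / r \<and>
     summable (\<lambda>i. \<gamma> i * r powi (- int i)) \<and>
     (\<lambda>m. limsup (\<lambda>n. ereal (1 / \<gamma> n * (\<Sum>i=m..n - m. \<gamma> (n - i) * \<gamma> i)))) \<longlonglongrightarrow> 0}"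

definition weight_function ::
    "real \<Rightarrow> nat \<Rightarrow> (nat \<Rightarrow> real) \<Rightarrow> (nat \<Rightarrow> real^'d^'d) \<Rightarrow> bool" where
  "weight_function r N \<phi> U \<longleftrightarrow>
     \<phi> \<in> W_class r \<and>
     (\<exists>A :: nat \<Rightarrow> real^'d^'d. \<forall>i<N.
        (\<lambda>n. (1 / \<phi> (N * n)) *\<^sub>R U (N * n + i)) \<longlonglongrightarrow> A i)"

definition WP_class :: "real \<Rightarrow> nat \<Rightarrow> (nat \<Rightarrow> real^'d^'d) set" where
  "WP_class r N = {U. \<exists>\<phi>. weight_function r N \<phi> U}"

end

theory Submission
  imports Defs
begin

text \<open>
  In terms of the generating functions \<open>\<Sum>\<^sub>n U(n) s\<^sup>n\<close> and \<open>\<Sum>\<^sub>n Z(n) s\<^sup>n\<close>, \<open>Z\<close> is the inverse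
  of \<open>I - s U(s)\<close>.  A one-sided inverse of such a power series, with constant term \<open>I\<close>, is two-sided
  (\<open>resolvent_commute\<close>), so the recursion may be read backwards, as a Volterra equation for
  \<open>U\<close> with forcing and kernel given by \<open>Z\<close>:
  \<open>U(n) = Z(n+1) - \<Sum>\<^sub>1\<^sub>\<le>\<^sub>j\<^sub>\<le>\<^sub>n Z(j) U(n-j)\<close>.

  The smallness of \<open>U\<close> makes this equation contractive.  Since \<open>r \<le> 1\<close>, the bound
  \<open>1 / (1 + r\<^sup>-\<^sup>N)\<close> is at most \<open>1/2\<close>; if the weighted row sums of \<open>U\<close> are at most
  \<open>v < 1/2\<close>, then those of \<open>Z(1), Z(2), \<dots>\<close> are at most \<open>v + v\<^sup>2 + \<dots> = v / (1 - v) < 1\<close>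
  (\<open>resolvent_sum_bound\<close>).

  The remaining part concerns Volterra equations with such a kernel.  Belonging to the class with
  weight \<open>\<phi>\<close> means that the sequence divided by \<open>\<phi>\<close> converges along each residue class
  modulo \<open>N\<close> (\<open>weight_function_iff_asymp_periodic\<close>).  The convolution is cut into three blocks.
  Where \<open>j\<close> is close to \<open>n\<close>, only finitely many values of the solution enter, and the
  known asymptotics of the kernel decide.  Where \<open>j\<close> is small, the block acts on the normalised
  solution almost like a convolution with the kernel weighted by \<open>r\<^sup>-\<^sup>j\<close>, a contraction in
  the supremum norm.  The middle block is negligible by the defining property of the weight.  Hence
  the normalised solution is bounded (\<open>x_bounded\<close>), and its asymptotic oscillation along
  residue classes is at most a factor less than one times itself (\<open>osc_le_contract\<close>), so
  it vanishes; by completeness the limits exist.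

  The order of the factors matters: the hypothesis bounds row sums of an entrywise sum over
  \<open>n\<close>, and multiplication from the left by matrices with small row sums contracts the largest
  entry, column by column.
\<close>

section \<open>Convergence along residue classes\<close>

definition asymp_periodic :: "nat \<Rightarrow> (nat \<Rightarrow> real) \<Rightarrow> bool" where
  "asymp_periodic N f \<longleftrightarrow> (\<forall>i<N. convergent (\<lambda>n. f (N * n + i)))"

lemma asymp_periodic_add:
  "asymp_periodic N f \<Longrightarrow> asymp_periodic N g \<Longrightarrow> asymp_periodic N (\<lambda>n. f n + g n)"
  unfolding asymp_periodic_def by (auto intro: convergent_add)

lemma asymp_periodic_mult:
  "asymp_periodic N f \<Longrightarrow> asymp_periodic N g \<Longrightarrow> asymp_periodic N (\<lambda>n. f n * g n)"
  unfolding asymp_periodic_def by (auto intro: convergent_mult)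

lemma asymp_periodic_const: "asymp_periodic N (\<lambda>n. c)"
  unfolding asymp_periodic_def by (auto intro: convergent_const)

lemma asymp_periodic_sum:
  "(\<And>i. i \<in> I \<Longrightarrow> asymp_periodic N (f i)) \<Longrightarrow> asymp_periodic N (\<lambda>n. \<Sum>i\<in>I. f i n)"
  unfolding asymp_periodic_def by (auto intro: convergent_sum)

lemma filterlim_arith_progression:
  assumes "N \<ge> 1"
  shows "filterlim (\<lambda>n::nat. N * n + i) sequentially sequentially"
  using assms
  by (intro filterlim_subseq) (auto simp: strict_mono_def)

lemma asymp_periodic_tendsto:
  assumes "N \<ge> 1" "f \<longlonglongrightarrow> l"
  shows "asymp_periodic N f"
  unfolding asymp_periodic_def convergent_def
  using filterlim_compose[OF assms(2) filterlim_arith_progression[OF assms(1)]] by blast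

lemma asymp_periodic_bounded:
  assumes "N \<ge> 1" "asymp_periodic N f"
  obtains C where "C > 0" "\<And>n. \<bar>f n\<bar> \<le> C"
proof -
  have "\<exists>C>0. \<forall>n. \<bar>f (N * n + i)\<bar> \<le> C" if "i < N" for i
    using convergent_imp_Bseq[of "\<lambda>n. f (N * n + i)"] assms that
    unfolding asymp_periodic_def Bseq_def by auto
  then obtain C where C: "\<And>i. i < N \<Longrightarrow> C i > 0" "\<And>i n. i < N \<Longrightarrow> \<bar>f (N * n + i)\<bar> \<le> C i"
    by metis
  show ?thesis
  proof
    show "(\<Sum>i<N. C i) > 0"
      using C(1) assms(1) by (intro sum_pos) (auto simp: lessThan_empty_iff)
    show "\<bar>f n\<bar> \<le> (\<Sum>i<N. C i)" for n
    proof -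
      have lt: "n mod N < N" using assms(1) by simp
      have "\<bar>f n\<bar> \<le> C (n mod N)" using C(2)[OF lt, of "n div N"] by simp
      also have "\<dots> \<le> (\<Sum>i<N. C i)"
        using lt C(1) by (intro member_le_sum) (auto intro: less_imp_le)
      finally show ?thesis .
    qed
  qed
qed

text \<open>
  By completeness, the limits need not be known: it suffices to control differences of terms whose
  indices are congruent modulo \<open>N\<close>.  In this form the notion is visibly insensitive to shifts
  of the index.
\<close>

lemma asymp_periodic_iff_Cauchy:
  assumes "N \<ge> 1"
  shows "asymp_periodic N f \<longleftrightarrow>
    (\<forall>\<epsilon>>0. \<forall>\<^sub>F M in sequentially. \<forall>n\<ge>M. \<forall>n'\<ge>M. n mod N = n' mod N \<longrightarrow> \<bar>f n - f n'\<bar> \<le> \<epsilon>)"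
    (is "_ \<longleftrightarrow> ?C")
proof
  assume ap: "asymp_periodic N f"
  show ?C
  proof (intro allI impI)
    fix \<epsilon> :: real assume "\<epsilon> > 0"
    have "\<exists>M. \<forall>a\<ge>M. \<forall>b\<ge>M. \<bar>f (N * a + i) - f (N * b + i)\<bar> \<le> \<epsilon>" if "i < N" for i
      using convergent_Cauchy[of "\<lambda>n. f (N * n + i)"] ap that \<open>\<epsilon> > 0\<close>
      unfolding asymp_periodic_def Cauchy_def dist_real_def by (meson less_imp_le)
    then obtain M where M: "\<And>i a b. i < N \<Longrightarrow> a \<ge> M i \<Longrightarrow> b \<ge> M i \<Longrightarrow>
        \<bar>f (N * a + i) - f (N * b + i)\<bar> \<le> \<epsilon>" by metis
    define L where "L = (\<Sum>i<N. M i)"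
    have L: "M i \<le> L" if "i < N" for i
      unfolding L_def using that by (intro member_le_sum) auto
    have "\<bar>f n - f n'\<bar> \<le> \<epsilon>" if "n \<ge> K" "n' \<ge> K" "n mod N = n' mod N" "K \<ge> N * L" for n n' K
    proof -
      have lt: "n mod N < N" using assms by simp
      have div: "k div N \<ge> M (n mod N)" if "k \<ge> N * L" for k
        using L[OF lt] div_le_mono[OF that, of N] assms by simp
      have "\<bar>f (N * (n div N) + n mod N) - f (N * (n' div N) + n mod N)\<bar> \<le> \<epsilon>"
        using that by (intro M lt div) linarith+
      moreover have "N * (n' div N) + n mod N = n'" using that(3) by simp
      ultimately show ?thesis by simp
    qed
    then show "\<forall>\<^sub>F M in sequentially. \<forall>n\<ge>M. \<forall>n'\<ge>M. n mod N = n' mod N \<longrightarrow> \<bar>f n - f n'\<bar> \<le> \<epsilon>"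
      unfolding eventually_sequentially by blast
  qed
next
  assume C: ?C
  show "asymp_periodic N f"
    unfolding asymp_periodic_def
  proof (intro allI impI)
    fix i assume "i < N"
    show "convergent (\<lambda>n. f (N * n + i))"
    proof (rule Cauchy_convergent, rule metric_CauchyI)
      fix e :: real assume "e > 0"
      then have "e / 2 > 0" by simp
      then obtain M where M: "\<And>n n'. n \<ge> M \<Longrightarrow> n' \<ge> M \<Longrightarrow> n mod N = n' mod N \<Longrightarrow>
          \<bar>f n - f n'\<bar> \<le> e / 2"
        using C unfolding eventually_sequentially by (metis order_refl)
      have ge: "N * a + i \<ge> M" if "a \<ge> M" for a
      proof -
        have "a \<le> N * a" using assms by (cases N) auto
        then show ?thesis using that by linarith
      qed
      have "dist (f (N * a + i)) (f (N * b + i)) < e" if "a \<ge> M" "b \<ge> M" for a b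
        using M[of "N * a + i" "N * b + i"] ge that \<open>e > 0\<close> by (simp add: dist_real_def)
      then show "\<exists>M. \<forall>m\<ge>M. \<forall>n\<ge>M. dist (f (N * m + i)) (f (N * n + i)) < e" by blast
    qed
  qed
qed

lemma asymp_periodic_shift:
  assumes "N \<ge> 1" "asymp_periodic N f"
  shows "asymp_periodic N (\<lambda>n. f (n + k))"
  unfolding asymp_periodic_iff_Cauchy[OF assms(1)]
proof (intro allI impI)
  fix \<epsilon> :: real assume "\<epsilon> > 0"
  then obtain M where M: "\<And>n n'. n \<ge> M \<Longrightarrow> n' \<ge> M \<Longrightarrow> n mod N = n' mod N \<Longrightarrow> \<bar>f n - f n'\<bar> \<le> \<epsilon>"
    using assms(2)[unfolded asymp_periodic_iff_Cauchy[OF assms(1)]]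
    unfolding eventually_sequentially by (metis order_refl)
  have "\<bar>f (n + k) - f (n' + k)\<bar> \<le> \<epsilon>" if "n \<ge> M" "n' \<ge> M" "n mod N = n' mod N" for n n'
    using that by (intro M) (auto intro: mod_add_cong)
  then show "\<forall>\<^sub>F M in sequentially. \<forall>n\<ge>M. \<forall>n'\<ge>M. n mod N = n' mod N \<longrightarrow> \<bar>f (n + k) - f (n' + k)\<bar> \<le> \<epsilon>"
    unfolding eventually_sequentially by (meson order_trans)
qed

lemma mod_diff_cong_nat:
  fixes n n' N j :: nat
  assumes "n mod N = n' mod N" "j \<le> n" "j \<le> n'"
  shows "(n - j) mod N = (n' - j) mod N"
proof -
  obtain a b where "n + N * a = n' + N * b" using assms(1) by (auto simp: nat_mod_eq_iff)
  then have "n - j + N * a = n' - j + N * b" using assms(2,3) by linarith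
  then show ?thesis unfolding nat_mod_eq_iff by blast
qed

lemma asymp_periodic_delay:
  assumes "N \<ge> 1" "asymp_periodic N f"
  shows "asymp_periodic N (\<lambda>n. f (n - k))"
  unfolding asymp_periodic_iff_Cauchy[OF assms(1)]
proof (intro allI impI)
  fix \<epsilon> :: real assume "\<epsilon> > 0"
  then obtain M where M: "\<And>n n'. n \<ge> M \<Longrightarrow> n' \<ge> M \<Longrightarrow> n mod N = n' mod N \<Longrightarrow> \<bar>f n - f n'\<bar> \<le> \<epsilon>"
    using assms(2)[unfolded asymp_periodic_iff_Cauchy[OF assms(1)]]
    unfolding eventually_sequentially by (metis order_refl)
  have "\<bar>f (n - k) - f (n' - k)\<bar> \<le> \<epsilon>"
    if "n \<ge> L" "n' \<ge> L" "n mod N = n' mod N" "L \<ge> M + k" for n n' L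
    using that by (intro M mod_diff_cong_nat) auto
  then show "\<forall>\<^sub>F M in sequentially. \<forall>n\<ge>M. \<forall>n'\<ge>M. n mod N = n' mod N \<longrightarrow> \<bar>f (n - k) - f (n' - k)\<bar> \<le> \<epsilon>"
    unfolding eventually_sequentially by blast
qed

section \<open>Subexponential weights\<close>

lemma W_class_pos: "\<phi> \<in> W_class r \<Longrightarrow> \<phi> n > 0"
  by (simp add: W_class_def)

lemma W_class_ratio_delay:
  assumes "\<phi> \<in> W_class r"
  shows "(\<lambda>n. \<phi> (n - j) / \<phi> n) \<longlonglongrightarrow> (1 / r) ^ j"
proof (induction j)
  case 0
  have "\<phi> n / \<phi> n = 1" for n using W_class_pos[OF assms, of n] by simp
  then show ?case by simp
next
  case (Suc j)
  have base: "(\<lambda>n. \<phi> (n - 1) / \<phi> n) \<longlonglongrightarrow> 1 / r" using assms by (simp add: W_class_def)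
  have "filterlim (\<lambda>n. n - j) sequentially sequentially"
    by (rule filterlim_minus_const_nat_at_top)
  from filterlim_compose[OF base this]
  have "(\<lambda>n. \<phi> (n - j - 1) / \<phi> (n - j)) \<longlonglongrightarrow> 1 / r" .
  from tendsto_mult[OF this Suc]
  have "(\<lambda>n. \<phi> (n - j - 1) / \<phi> (n - j) * (\<phi> (n - j) / \<phi> n)) \<longlonglongrightarrow> 1 / r * (1 / r) ^ j" .
  moreover have "\<phi> (n - j - 1) / \<phi> (n - j) * (\<phi> (n - j) / \<phi> n) = \<phi> (n - Suc j) / \<phi> n" for n
    using W_class_pos[OF assms, of "n - j"] by simp
  ultimately show ?case by (simp only: power_Suc)
qed

lemma W_class_ratio_shift:
  assumes "\<phi> \<in> W_class r" "r > 0"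
  shows "(\<lambda>n. \<phi> (n + j) / \<phi> n) \<longlonglongrightarrow> r ^ j"
proof -
  have "(\<lambda>n. \<phi> (n + j - j) / \<phi> (n + j)) \<longlonglongrightarrow> (1 / r) ^ j"
    by (rule LIMSEQ_ignore_initial_segment[OF W_class_ratio_delay[OF assms(1)]])
  then have "(\<lambda>n. inverse (\<phi> n / \<phi> (n + j))) \<longlonglongrightarrow> inverse ((1 / r) ^ j)"
    using assms(2) by (intro tendsto_inverse) auto
  then show ?thesis by (simp add: power_one_over inverse_eq_divide)
qed

text \<open>
  The form in which the double limit enters the estimates: one cut-off \<open>m\<close> for each
  admissible error \<open>\<eta>\<close>.
\<close>

lemma W_class_middle_small:
  assumes "\<phi> \<in> W_class r" "\<eta> > 0"
  shows "\<exists>m\<ge>1. \<forall>\<^sub>F n in sequentially. 1 / \<phi> n * (\<Sum>i=m..n - m. \<phi> (n - i) * \<phi> i) \<le> \<eta>"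
proof -
  have "(\<lambda>m. limsup (\<lambda>n. ereal (1 / \<phi> n * (\<Sum>i=m..n - m. \<phi> (n - i) * \<phi> i)))) \<longlonglongrightarrow> 0"
    using assms(1) by (simp add: W_class_def)
  then have "\<forall>\<^sub>F m in sequentially.
      limsup (\<lambda>n. ereal (1 / \<phi> n * (\<Sum>i=m..n - m. \<phi> (n - i) * \<phi> i))) < ereal \<eta>"
    by (rule order_tendstoD) (use assms(2) in simp)
  then obtain m where "m \<ge> 1"
    and m: "limsup (\<lambda>n. ereal (1 / \<phi> n * (\<Sum>i=m..n - m. \<phi> (n - i) * \<phi> i))) < ereal \<eta>"
    unfolding eventually_sequentially by (meson max.cobounded1 max.cobounded2)
  from Limsup_lessD[OF m] have "\<forall>\<^sub>F n in sequentially. 1 / \<phi> n * (\<Sum>i=m..n - m. \<phi> (n - i) * \<phi> i) \<le> \<eta>"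
    by eventually_elim simp
  with \<open>m \<ge> 1\<close> show ?thesis by blast
qed

text \<open>
  Normalising \<open>U(Nn+i)\<close> by \<open>\<phi>(Nn)\<close> or by \<open>\<phi>(Nn+i)\<close> makes no difference to the existence
  of limits, because the quotient of the two weights tends to \<open>r\<^sup>i \<noteq> 0\<close>.
\<close>

lemma weight_function_iff_asymp_periodic:
  fixes U :: "nat \<Rightarrow> real^'d^'d"
  assumes \<phi>: "\<phi> \<in> W_class r" and r: "r > 0" and N: "N \<ge> 1"
  shows "weight_function r N \<phi> U \<longleftrightarrow> (\<forall>p q. asymp_periodic N (\<lambda>n. U n $ p $ q / \<phi> n))"
proof -
  have conv: "convergent (\<lambda>n. U (N * n + i) $ p $ q / \<phi> (N * n)) \<longleftrightarrow>
      convergent (\<lambda>n. U (N * n + i) $ p $ q / \<phi> (N * n + i))" (is "convergent ?f \<longleftrightarrow> convergent ?g") for i p q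
  proof -
    have lim: "(\<lambda>n. \<phi> (N * n + i) / \<phi> (N * n)) \<longlonglongrightarrow> r ^ i"
      using filterlim_compose[OF W_class_ratio_shift[OF \<phi> r] filterlim_arith_progression[OF N, of 0]]
      by simp
    have lim': "(\<lambda>n. inverse (\<phi> (N * n + i) / \<phi> (N * n))) \<longlonglongrightarrow> inverse (r ^ i)"
      by (rule tendsto_inverse[OF lim]) (use r in simp)
    have *: "?f = (\<lambda>n. ?g n * (\<phi> (N * n + i) / \<phi> (N * n)))"
      "?g = (\<lambda>n. ?f n * inverse (\<phi> (N * n + i) / \<phi> (N * n)))"
      using W_class_pos[OF \<phi>] by (auto simp: fun_eq_iff less_imp_neq[symmetric])
    show ?thesis
    proof
      assume "convergent ?f"
      from convergent_mult[OF this convergentI[OF lim']] show "convergent ?g"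
        by (simp only: *(2)[symmetric])
    next
      assume "convergent ?g"
      from convergent_mult[OF this convergentI[OF lim]] show "convergent ?f"
        by (simp only: *(1)[symmetric])
    qed
  qed
  have "(\<exists>A :: nat \<Rightarrow> real^'d^'d. \<forall>i<N. (\<lambda>n. (1 / \<phi> (N * n)) *\<^sub>R U (N * n + i)) \<longlonglongrightarrow> A i) \<longleftrightarrow>
      (\<forall>i<N. convergent (\<lambda>n. (1 / \<phi> (N * n)) *\<^sub>R U (N * n + i)))"
    unfolding convergent_def by (rule choice_iff'[symmetric])
  moreover have "convergent (\<lambda>n. (1 / \<phi> (N * n)) *\<^sub>R U (N * n + i)) \<longleftrightarrow>
      (\<forall>p q. convergent (\<lambda>n. U (N * n + i) $ p $ q / \<phi> (N * n)))" for i
  proof (rule iffI, intro allI)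
    fix p q
    assume "convergent (\<lambda>n. (1 / \<phi> (N * n)) *\<^sub>R U (N * n + i))"
    then obtain L where "(\<lambda>n. (1 / \<phi> (N * n)) *\<^sub>R U (N * n + i)) \<longlonglongrightarrow> L"
      unfolding convergent_def by blast
    then have "(\<lambda>n. ((1 / \<phi> (N * n)) *\<^sub>R U (N * n + i)) $ p $ q) \<longlonglongrightarrow> L $ p $ q"
      by (intro tendsto_vec_nth)
    then show "convergent (\<lambda>n. U (N * n + i) $ p $ q / \<phi> (N * n))"
      unfolding convergent_def by auto
  next
    assume "\<forall>p q. convergent (\<lambda>n. U (N * n + i) $ p $ q / \<phi> (N * n))"
    then obtain L where L: "\<And>p q. (\<lambda>n. U (N * n + i) $ p $ q / \<phi> (N * n)) \<longlonglongrightarrow> L p q"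
      unfolding convergent_def by metis
    have "(\<lambda>n. (1 / \<phi> (N * n)) *\<^sub>R U (N * n + i)) \<longlonglongrightarrow> (\<chi> p q. L p q)"
      by (intro vec_tendstoI) (use L in simp)
    then show "convergent (\<lambda>n. (1 / \<phi> (N * n)) *\<^sub>R U (N * n + i))" by (rule convergentI)
  qed
  ultimately show ?thesis
    unfolding weight_function_def asymp_periodic_def using \<phi> by (auto simp: conv)
qed

section \<open>Volterra equations with subexponential kernels\<close>

text \<open>
  The unknown \<open>y\<close> is vector-valued with index type \<open>'d\<close>.  The smallness condition
  bounds each row of the weighted kernel, so that the convolution is a contraction for the maximum
  over all entries.
\<close>

locale subexponential_volterra =
  fixes \<phi> :: "nat \<Rightarrow> real" and r :: real and N :: nat
    and g y :: "nat \<Rightarrow> 'd::finite \<Rightarrow> real" and K :: "nat \<Rightarrow> 'd \<Rightarrow> 'd \<Rightarrow> real" and \<beta> :: real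
  assumes \<phi>: "\<phi> \<in> W_class r" and r: "r > 0" and N: "N \<ge> 1"
    and y_eq: "y n p = g n p + (\<Sum>j=1..n. \<Sum>s\<in>UNIV. K j p s * y (n - j) s)"
    and g_ap: "asymp_periodic N (\<lambda>n. g n p / \<phi> n)"
    and K_ap: "asymp_periodic N (\<lambda>n. K n p s / \<phi> n)"
    and K_small: "(\<Sum>j=1..n. \<Sum>s\<in>UNIV. \<bar>K j p s\<bar> * (1 / r) ^ j) \<le> \<beta>"
    and \<beta>: "\<beta> < 1"
begin

definition x :: "nat \<Rightarrow> 'd \<Rightarrow> real" where "x n p = y n p / \<phi> n"

text \<open>
  For fixed \<open>m\<close> this part depends on the solution only through \<open>y 0, \<dots>, y (m - 1)\<close>,
  so its asymptotics are those of the data.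
\<close>

definition ends :: "nat \<Rightarrow> nat \<Rightarrow> 'd \<Rightarrow> real" where
  "ends m n p = g n p / \<phi> n + (\<Sum>k<m. \<Sum>s\<in>UNIV. K (n - k) p s / \<phi> n * y k s)"

definition middle :: "nat \<Rightarrow> nat \<Rightarrow> 'd \<Rightarrow> real" where
  "middle m n p = (\<Sum>j=m..n - m. \<Sum>s\<in>UNIV. K j p s * y (n - j) s) / \<phi> n"

lemma \<phi>_pos: "\<phi> n > 0"
  by (rule W_class_pos[OF \<phi>])

lemma y_conv_x: "y n p = \<phi> n * x n p"
  using \<phi>_pos[of n] by (simp add: x_def)

lemma x_split:
  assumes "m \<ge> 1" "n \<ge> 2 * m"
  shows "x n p = ends m n p
    + (\<Sum>j=1..<m. \<Sum>s\<in>UNIV. K j p s * (\<phi> (n - j) / \<phi> n * x (n - j) s)) + middle m n p"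
proof -
  define t where "t j = (\<Sum>s\<in>UNIV. K j p s * y (n - j) s)" for j
  have split: "{1..n} = {1..<m} \<union> {m..n - m} \<union> {n - m<..n}" using assms by auto
  have "(\<Sum>j=1..n. t j) = (\<Sum>j=1..<m. t j) + (\<Sum>j=m..n - m. t j) + (\<Sum>j\<in>{n - m<..n}. t j)"
    unfolding split using assms by (subst sum.union_disjoint; (subst sum.union_disjoint)?) auto
  moreover have "(\<Sum>j\<in>{n - m<..n}. t j) = (\<Sum>k<m. t (n - k))"
    by (rule sum.reindex_bij_witness[of _ "\<lambda>k. n - k" "\<lambda>k. n - k"]) (use assms in auto)
  moreover have "(\<Sum>k<m. t (n - k)) = (\<Sum>k<m. \<Sum>s\<in>UNIV. K (n - k) p s * y k s)"
    unfolding t_def by (intro sum.cong refl) (use assms in auto)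
  moreover have "(\<Sum>j=1..<m. t j) / \<phi> n =
      (\<Sum>j=1..<m. \<Sum>s\<in>UNIV. K j p s * (\<phi> (n - j) / \<phi> n * x (n - j) s))"
    unfolding t_def sum_divide_distrib by (intro sum.cong refl) (simp add: y_conv_x)
  ultimately show ?thesis
    unfolding x_def[of n] y_eq[of n] ends_def middle_def t_def[symmetric]
    by (simp add: add_divide_distrib sum_divide_distrib)
qed

lemma ends_asymp_periodic: "asymp_periodic N (\<lambda>n. ends m n p)"
proof -
  have *: "K (n - k) p s / \<phi> n * y k s = (K (n - k) p s / \<phi> (n - k)) * (\<phi> (n - k) / \<phi> n) * y k s" for n k s
    using \<phi>_pos[of "n - k"] by simp
  have "asymp_periodic N (\<lambda>n. K (n - k) p s / \<phi> n * y k s)" for k s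
    unfolding *
    by (intro asymp_periodic_mult asymp_periodic_const asymp_periodic_delay[OF N K_ap]
        asymp_periodic_tendsto[OF N W_class_ratio_delay[OF \<phi>]])
  then show ?thesis
    unfolding ends_def by (intro asymp_periodic_add g_ap asymp_periodic_sum)
qed

lemma K_bounded:
  obtains B where "B > 0" "\<And>n p s. \<bar>K n p s\<bar> \<le> B * \<phi> n"
proof -
  have "\<exists>C>0. \<forall>n. \<bar>K n p s / \<phi> n\<bar> \<le> C" for p s
    using asymp_periodic_bounded[OF N K_ap[of p s]] by metis
  then obtain C where C: "\<And>p s. C p s > 0" "\<And>p s n. \<bar>K n p s / \<phi> n\<bar> \<le> C p s" by metis
  show ?thesis
  proof
    show "(\<Sum>p\<in>UNIV. \<Sum>s\<in>UNIV. C p s) > 0"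
      by (intro sum_pos C) auto
    show "\<bar>K n p s\<bar> \<le> (\<Sum>p\<in>UNIV. \<Sum>s\<in>UNIV. C p s) * \<phi> n" for n p s
    proof -
      have "C p s \<le> (\<Sum>s\<in>UNIV. C p s)"
        using C(1) by (intro member_le_sum) (auto intro: less_imp_le)
      also have "\<dots> \<le> (\<Sum>p\<in>UNIV. \<Sum>s\<in>UNIV. C p s)"
        using C(1) by (intro member_le_sum[where f = "\<lambda>p. \<Sum>s\<in>UNIV. C p s"] sum_nonneg)
          (auto intro: less_imp_le)
      finally have "\<bar>K n p s / \<phi> n\<bar> \<le> (\<Sum>p\<in>UNIV. \<Sum>s\<in>UNIV. C p s)"
        using C(2)[of n p s] by linarith
      then show ?thesis using \<phi>_pos[of n] by (simp add: abs_divide field_simps)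
    qed
  qed
qed

lemma K_sum_bound:
  assumes "\<And>j s. 1 \<le> j \<Longrightarrow> j < m \<Longrightarrow> \<bar>v j s\<bar> \<le> c * (1 / r) ^ j" "c \<ge> 0"
  shows "\<bar>\<Sum>j=1..<m. \<Sum>s\<in>UNIV. K j p s * v j s\<bar> \<le> \<beta> * c"
proof -
  have "\<bar>\<Sum>j=1..<m. \<Sum>s\<in>UNIV. K j p s * v j s\<bar> \<le> (\<Sum>j=1..<m. \<Sum>s\<in>UNIV. \<bar>K j p s * v j s\<bar>)"
    by (intro order_trans[OF sum_abs] sum_mono sum_abs)
  also have "\<dots> \<le> (\<Sum>j=1..<m. \<Sum>s\<in>UNIV. \<bar>K j p s\<bar> * (1 / r) ^ j * c)"
    unfolding abs_mult using assms(1)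
    by (intro sum_mono) (auto intro!: mult_left_mono simp: mult.assoc mult.commute[of c])
  also have "\<dots> = (\<Sum>j=1..<m. \<Sum>s\<in>UNIV. \<bar>K j p s\<bar> * (1 / r) ^ j) * c"
    by (simp add: sum_distrib_right)
  also have "\<dots> \<le> \<beta> * c"
  proof (rule mult_right_mono[OF _ assms(2)])
    have "(\<Sum>j=1..<m. \<Sum>s\<in>UNIV. \<bar>K j p s\<bar> * (1 / r) ^ j)
        \<le> (\<Sum>j=1..m. \<Sum>s\<in>UNIV. \<bar>K j p s\<bar> * (1 / r) ^ j)"
      using r by (intro sum_mono2 sum_nonneg) auto
    then show "(\<Sum>j=1..<m. \<Sum>s\<in>UNIV. \<bar>K j p s\<bar> * (1 / r) ^ j) \<le> \<beta>"
      using K_small[of p m] by linarith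
  qed
  finally show ?thesis .
qed

lemma \<beta>_nonneg: "\<beta> \<ge> 0"
  using K_small[of _ 0] by simp

text \<open>
  Only a bound on the earlier values of \<open>x\<close> is required, and \<open>m\<close> does not depend on it.
  This allows the estimate to be used in an induction proving that \<open>x\<close> is bounded.
\<close>

lemma middle_bound:
  assumes "\<delta> > 0"
  shows "\<exists>m\<ge>1. \<forall>\<^sub>F n in sequentially. \<forall>M\<ge>0. (\<forall>k<n. \<forall>s. \<bar>x k s\<bar> \<le> M) \<longrightarrow> (\<forall>p. \<bar>middle m n p\<bar> \<le> \<delta> * M)"
proof -
  obtain B where B: "B > 0" "\<And>n p s. \<bar>K n p s\<bar> \<le> B * \<phi> n" by (rule K_bounded) blast
  define D where "D = real CARD('d) * B"
  have D: "D > 0" unfolding D_def using B(1) by simp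
  obtain m where m: "m \<ge> 1" "\<forall>\<^sub>F n in sequentially. 1 / \<phi> n * (\<Sum>i=m..n - m. \<phi> (n - i) * \<phi> i) \<le> \<delta> / D"
    using W_class_middle_small[OF \<phi>, of "\<delta> / D"] assms D by auto
  from m(2) have "\<forall>\<^sub>F n in sequentially. \<forall>M\<ge>0. (\<forall>k<n. \<forall>s. \<bar>x k s\<bar> \<le> M) \<longrightarrow> (\<forall>p. \<bar>middle m n p\<bar> \<le> \<delta> * M)"
  proof eventually_elim
    case (elim n)
    show ?case
    proof (intro allI impI)
      fix M :: real and p assume "M \<ge> 0" and M: "\<forall>k<n. \<forall>s. \<bar>x k s\<bar> \<le> M"
      have summand: "\<bar>K j p s * y (n - j) s\<bar> \<le> B * M * (\<phi> (n - j) * \<phi> j)" if "j \<in> {m..n - m}" for j s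
      proof -
        have "n - j < n" using that m(1) by auto
        then have "\<bar>x (n - j) s\<bar> \<le> M" using M by blast
        then have "\<phi> (n - j) * \<bar>x (n - j) s\<bar> \<le> \<phi> (n - j) * M"
          by (rule mult_left_mono) (rule less_imp_le[OF \<phi>_pos])
        then have "\<bar>y (n - j) s\<bar> \<le> \<phi> (n - j) * M"
          by (simp only: y_conv_x abs_mult abs_of_pos[OF \<phi>_pos])
        then have "\<bar>K j p s * y (n - j) s\<bar> \<le> (B * \<phi> j) * (\<phi> (n - j) * M)"
          unfolding abs_mult using B \<phi>_pos[of j] by (intro mult_mono) (auto simp: less_imp_le)
        then show ?thesis by (simp add: algebra_simps)
      qed
      have "\<bar>\<Sum>j=m..n - m. \<Sum>s\<in>UNIV. K j p s * y (n - j) s\<bar>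
          \<le> (\<Sum>j=m..n - m. \<Sum>s\<in>(UNIV :: 'd set). B * M * (\<phi> (n - j) * \<phi> j))"
        by (intro order_trans[OF sum_abs] sum_mono summand)
      also have "\<dots> = D * M * (\<Sum>j=m..n - m. \<phi> (n - j) * \<phi> j)"
        by (simp add: D_def sum_distrib_left mult.assoc)
      finally have "\<bar>middle m n p\<bar> \<le> D * M * (\<Sum>j=m..n - m. \<phi> (n - j) * \<phi> j) / \<phi> n"
        unfolding middle_def abs_divide using \<phi>_pos[of n] by (simp add: divide_right_mono)
      also have "\<dots> = D * M * (1 / \<phi> n * (\<Sum>j=m..n - m. \<phi> (n - j) * \<phi> j))" by simp
      also have "\<dots> \<le> D * M * (\<delta> / D)"
        using elim D \<open>M \<ge> 0\<close> by (intro mult_left_mono) auto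
      finally show "\<bar>middle m n p\<bar> \<le> \<delta> * M" using D by (simp add: mult.commute)
    qed
  qed
  with m(1) show ?thesis by blast
qed

text \<open>
  For large \<open>n\<close> the three blocks give
  \<open>|x n| \<le> const + (\<beta> (1 + \<delta>) + \<delta>) M\<close> whenever \<open>M\<close> bounds all earlier values.
  The factor of \<open>M\<close> is less than one, so a large enough bound reproduces itself.
\<close>

lemma x_bounded: obtains C where "C > 0" "\<And>n p. \<bar>x n p\<bar> \<le> C"
proof -
  define \<delta> where "\<delta> = (1 - \<beta>) / 4"
  have \<delta>: "\<delta> > 0" "\<beta> * (1 + \<delta>) + \<delta> \<le> 1 - \<delta>"
    using \<beta> \<beta>_nonneg mult_right_mono[of \<beta> 1 \<delta>] unfolding \<delta>_def by (auto simp: field_simps)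
  obtain m where m: "m \<ge> 1" and mid: "\<forall>\<^sub>F n in sequentially. \<forall>M\<ge>0. (\<forall>k<n. \<forall>s. \<bar>x k s\<bar> \<le> M) \<longrightarrow>
      (\<forall>p. \<bar>middle m n p\<bar> \<le> \<delta> * M)"
    using middle_bound[OF \<delta>(1)] by blast
  have "\<exists>C>0. \<forall>n. \<bar>ends m n p\<bar> \<le> C" for p
    using asymp_periodic_bounded[OF N ends_asymp_periodic[of m p]] by metis
  then obtain E where E: "\<And>p. E p > 0" "\<And>p n. \<bar>ends m n p\<bar> \<le> E p" by metis
  define E' where "E' = (\<Sum>p\<in>UNIV. E p)"
  have E': "\<bar>ends m n p\<bar> \<le> E'" for n p
  proof -
    have "E p \<le> E'"
      unfolding E'_def using E(1) by (intro member_le_sum) (auto intro: less_imp_le)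
    with E(2)[of n p] show ?thesis by linarith
  qed
  have "\<forall>\<^sub>F n in sequentially. \<phi> (n - j) / \<phi> n \<le> (1 + \<delta>) * (1 / r) ^ j" for j
  proof -
    have "(1 / r) ^ j < (1 + \<delta>) * (1 / r) ^ j" using \<delta>(1) r by simp
    from order_tendstoD(2)[OF W_class_ratio_delay[OF \<phi>] this] show ?thesis
      by eventually_elim simp
  qed
  then have "\<forall>\<^sub>F n in sequentially. \<forall>j\<in>{1..<m}. \<phi> (n - j) / \<phi> n \<le> (1 + \<delta>) * (1 / r) ^ j"
    by (intro eventually_ball_finite) auto
  with mid eventually_ge_at_top[of "2 * m"]
  have "\<forall>\<^sub>F n in sequentially. (\<forall>j\<in>{1..<m}. \<phi> (n - j) / \<phi> n \<le> (1 + \<delta>) * (1 / r) ^ j) \<and> n \<ge> 2 * m \<and>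
      (\<forall>M\<ge>0. (\<forall>k<n. \<forall>s. \<bar>x k s\<bar> \<le> M) \<longrightarrow> (\<forall>p. \<bar>middle m n p\<bar> \<le> \<delta> * M))"
    by eventually_elim blast
  then obtain n0 where n0: "\<And>n j. n \<ge> n0 \<Longrightarrow> j \<in> {1..<m} \<Longrightarrow> \<phi> (n - j) / \<phi> n \<le> (1 + \<delta>) * (1 / r) ^ j"
    "\<And>n. n \<ge> n0 \<Longrightarrow> n \<ge> 2 * m"
    "\<And>n M p. n \<ge> n0 \<Longrightarrow> M \<ge> 0 \<Longrightarrow> \<forall>k<n. \<forall>s. \<bar>x k s\<bar> \<le> M \<Longrightarrow> \<bar>middle m n p\<bar> \<le> \<delta> * M"
    unfolding eventually_sequentially by blast
  \<comment> \<open>Large enough to absorb the constant and to cover the indices below \<open>n0\<close>.\<close>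
  define C where "C = max (E' / \<delta>) (\<Sum>k<n0. \<Sum>s\<in>UNIV. \<bar>x k s\<bar>) + 1"
  have E'_nonneg: "E' \<ge> 0" using E'[of 0 undefined] by linarith
  have C: "C > 0" "E' \<le> \<delta> * C"
  proof -
    have "E' / \<delta> \<ge> 0" using E'_nonneg \<delta>(1) by simp
    then show "C > 0" unfolding C_def by linarith
    have "E' / \<delta> \<le> C" unfolding C_def by linarith
    then show "E' \<le> \<delta> * C" using \<delta>(1) by (simp add: field_simps)
  qed
  have "\<forall>p. \<bar>x n p\<bar> \<le> C" for n
  proof (induction n rule: less_induct)
    case (less n)
    show ?case
    proof (cases "n < n0")
      case True
      show ?thesis
      proof
        fix p
        have "\<bar>x n p\<bar> \<le> (\<Sum>s\<in>UNIV. \<bar>x n s\<bar>)" by (intro member_le_sum) auto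
        also have "\<dots> \<le> (\<Sum>k<n0. \<Sum>s\<in>UNIV. \<bar>x k s\<bar>)"
          using True by (intro member_le_sum[where f = "\<lambda>k. \<Sum>s\<in>UNIV. \<bar>x k s\<bar>"] sum_nonneg) auto
        finally show "\<bar>x n p\<bar> \<le> C" unfolding C_def by linarith
      qed
    next
      case False
      then have n: "n \<ge> n0" by simp
      show ?thesis
      proof
        fix p
        have "\<bar>\<phi> (n - j) / \<phi> n * x (n - j) s\<bar> \<le> (1 + \<delta>) * C * (1 / r) ^ j" if "1 \<le> j" "j < m" for j s
        proof -
          have "n - j < n" using n0(2)[OF n] that m by linarith
          then have "\<bar>x (n - j) s\<bar> \<le> C" using less by blast
          then have "\<bar>\<phi> (n - j) / \<phi> n * x (n - j) s\<bar> \<le> ((1 + \<delta>) * (1 / r) ^ j) * C"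
            unfolding abs_mult using n0(1)[OF n, of j] that \<phi>_pos[of n] \<phi>_pos[of "n - j"] \<delta>(1) r
            by (intro mult_mono) auto
          then show ?thesis by (simp add: algebra_simps)
        qed
        then have "\<bar>\<Sum>j=1..<m. \<Sum>s\<in>UNIV. K j p s * (\<phi> (n - j) / \<phi> n * x (n - j) s)\<bar> \<le> \<beta> * ((1 + \<delta>) * C)"
          using \<delta>(1) C(1) by (intro K_sum_bound) auto
        moreover have "\<bar>middle m n p\<bar> \<le> \<delta> * C"
          using n0(3)[OF n, of C p] less C(1) by auto
        moreover have "\<bar>ends m n p\<bar> \<le> \<delta> * C" using E'[of n p] C(2) by linarith
        ultimately have "\<bar>x n p\<bar> \<le> \<delta> * C + \<beta> * ((1 + \<delta>) * C) + \<delta> * C"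
          unfolding x_split[OF m n0(2)[OF n]] by linarith
        also have "\<dots> = (\<beta> * (1 + \<delta>) + \<delta>) * C + \<delta> * C" by (simp add: algebra_simps)
        also have "\<dots> \<le> (1 - \<delta>) * C + \<delta> * C"
          using \<delta>(2) C(1) by (intro add_right_mono mult_right_mono) auto
        finally show "\<bar>x n p\<bar> \<le> C" by (simp add: algebra_simps)
      qed
    qed
  qed
  with C(1) that show ?thesis by blast
qed

definition osc_le :: "real \<Rightarrow> nat \<Rightarrow> (nat \<Rightarrow> real) \<Rightarrow> bool" where
  "osc_le c M f \<longleftrightarrow> (\<forall>n\<ge>M. \<forall>n'\<ge>M. n mod N = n' mod N \<longrightarrow> \<bar>f n - f n'\<bar> \<le> c)"

text \<open>
  The difference of \<open>x\<close> at two congruent indices is, up to small errors, the weighted kernel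
  convolved with differences of \<open>x\<close> at congruent indices, because removing the same
  \<open>j\<close> from both preserves the congruence.
\<close>

lemma osc_le_contract:
  assumes osc: "\<forall>\<^sub>F M in sequentially. \<forall>p. osc_le c M (\<lambda>n. x n p)" and c: "c \<ge> 0" and \<epsilon>: "\<epsilon> > 0"
  shows "\<forall>\<^sub>F M in sequentially. \<forall>p. osc_le (\<beta> * c + \<epsilon>) M (\<lambda>n. x n p)"
proof -
  obtain C where C: "C > 0" "\<And>n p. \<bar>x n p\<bar> \<le> C" by (rule x_bounded) blast
  define \<delta> where "\<delta> = \<epsilon> / (3 * C)"
  have "\<epsilon> / 3 > 0" using \<epsilon> by simp
  have \<delta>: "\<delta> > 0" "\<delta> * C = \<epsilon> / 3" unfolding \<delta>_def using \<epsilon> C(1) by auto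
  obtain m where m: "m \<ge> 1" and mid: "\<forall>\<^sub>F n in sequentially. \<forall>M\<ge>0. (\<forall>k<n. \<forall>s. \<bar>x k s\<bar> \<le> M) \<longrightarrow>
      (\<forall>p. \<bar>middle m n p\<bar> \<le> \<delta> * M)"
    using middle_bound[OF \<delta>(1)] by blast
  from mid have mid': "\<forall>\<^sub>F n in sequentially. \<forall>p. \<bar>middle m n p\<bar> \<le> \<epsilon> / 3"
  proof eventually_elim
    case (elim n)
    then show ?case using C unfolding \<delta>(2)[symmetric] by (auto simp: less_imp_le)
  qed
  \<comment> \<open>Replacing the weight quotients by their limits costs null sequences, which are put into
    the asymptotically periodic part.\<close>
  define P where "P n p = ends m n p
      + (\<Sum>j=1..<m. \<Sum>s\<in>UNIV. K j p s * ((\<phi> (n - j) / \<phi> n - (1 / r) ^ j) * x (n - j) s))" for n p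
  have "(\<lambda>n. (\<phi> (n - j) / \<phi> n - (1 / r) ^ j) * x (n - j) s) \<longlonglongrightarrow> 0" for j s
  proof (rule Lim_null_comparison)
    show "\<forall>\<^sub>F n in sequentially. norm ((\<phi> (n - j) / \<phi> n - (1 / r) ^ j) * x (n - j) s)
        \<le> \<bar>\<phi> (n - j) / \<phi> n - (1 / r) ^ j\<bar> * C"
      using C(2) by (intro always_eventually allI) (auto simp: abs_mult intro!: mult_left_mono)
    have "(\<lambda>n. \<phi> (n - j) / \<phi> n - (1 / r) ^ j) \<longlonglongrightarrow> 0"
      using W_class_ratio_delay[OF \<phi>] by (simp add: LIM_zero_iff)
    from tendsto_mult_right[OF tendsto_rabs[OF this], of C]
    show "(\<lambda>n. \<bar>\<phi> (n - j) / \<phi> n - (1 / r) ^ j\<bar> * C) \<longlonglongrightarrow> 0" by simp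
  qed
  then have "asymp_periodic N (\<lambda>n. P n p)" for p
    unfolding P_def
    by (intro asymp_periodic_add ends_asymp_periodic asymp_periodic_sum asymp_periodic_mult
        asymp_periodic_const asymp_periodic_tendsto[OF N])
  then have "\<forall>\<^sub>F M in sequentially. osc_le (\<epsilon> / 3) M (\<lambda>n. P n p)" for p
    unfolding asymp_periodic_iff_Cauchy[OF N] osc_le_def
    using \<open>\<epsilon> / 3 > 0\<close> by blast
  then have "\<forall>\<^sub>F M in sequentially. \<forall>p. osc_le (\<epsilon> / 3) M (\<lambda>n. P n p)"
    by (simp add: eventually_all_finite)
  moreover have "\<forall>\<^sub>F M in sequentially. \<forall>p. osc_le c (M - m) (\<lambda>n. x n p)"
    using osc by (rule eventually_compose_filterlim) (rule filterlim_minus_const_nat_at_top)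
  moreover have "\<forall>\<^sub>F M in sequentially. \<forall>n\<ge>M. \<forall>p. \<bar>middle m n p\<bar> \<le> \<epsilon> / 3"
    using mid' by (rule eventually_all_ge_at_top)
  ultimately show ?thesis using eventually_ge_at_top[of "2 * m"]
  proof eventually_elim
    case (elim L)
    show ?case unfolding osc_le_def
    proof (intro allI impI)
      fix p n n' assume n: "n \<ge> L" "n' \<ge> L" "n mod N = n' mod N"
      have x_eq: "x k p = P k p + (\<Sum>j=1..<m. \<Sum>s\<in>UNIV. K j p s * ((1 / r) ^ j * x (k - j) s))
          + middle m k p" if "k \<ge> L" for k
        unfolding P_def using that elim(4)
        by (subst x_split[OF m]) (auto simp: algebra_simps sum.distrib sum_subtractf)
      have "\<bar>(1 / r) ^ j * (x (n - j) s - x (n' - j) s)\<bar> \<le> c * (1 / r) ^ j" if "1 \<le> j" "j < m" for j s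
      proof -
        have "\<bar>x (n - j) s - x (n' - j) s\<bar> \<le> c"
        proof -
          have "(n - j) mod N = (n' - j) mod N"
            using n that elim(4) by (intro mod_diff_cong_nat) auto
          moreover have "n - j \<ge> L - m" "n' - j \<ge> L - m" using n that by auto
          ultimately show ?thesis using elim(2) unfolding osc_le_def by blast
        qed
        then show ?thesis using r by (simp add: abs_mult mult.commute[of c] divide_right_mono)
      qed
      then have "\<bar>\<Sum>j=1..<m. \<Sum>s\<in>UNIV. K j p s * ((1 / r) ^ j * (x (n - j) s - x (n' - j) s))\<bar> \<le> \<beta> * c"
        by (intro K_sum_bound c)
      moreover have "(\<Sum>j=1..<m. \<Sum>s\<in>UNIV. K j p s * ((1 / r) ^ j * (x (n - j) s - x (n' - j) s))) =
          (\<Sum>j=1..<m. \<Sum>s\<in>UNIV. K j p s * ((1 / r) ^ j * x (n - j) s)) -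
          (\<Sum>j=1..<m. \<Sum>s\<in>UNIV. K j p s * ((1 / r) ^ j * x (n' - j) s))"
        by (simp add: right_diff_distrib sum_subtractf)
      moreover have "\<bar>P n p - P n' p\<bar> \<le> \<epsilon> / 3" using elim(1) n unfolding osc_le_def by blast
      moreover have "\<bar>middle m n p\<bar> \<le> \<epsilon> / 3" "\<bar>middle m n' p\<bar> \<le> \<epsilon> / 3" using elim(3) n by blast+
      ultimately show "\<bar>x n p - x n' p\<bar> \<le> \<beta> * c + \<epsilon>"
        unfolding x_eq[OF n(1)] x_eq[OF n(2)] by linarith
    qed
  qed
qed

text \<open>
  Iterating the contraction, with an error term proportional to the current oscillation, drives the
  oscillation geometrically to zero.
\<close>

lemma solution_asymp_periodic: "asymp_periodic N (\<lambda>n. y n p / \<phi> n)"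
proof -
  obtain C where C: "C > 0" "\<And>n p. \<bar>x n p\<bar> \<le> C" by (rule x_bounded) blast
  \<comment> \<open>Any factor strictly between \<open>\<beta>\<close> and \<open>1\<close> leaves room for the error term.\<close>
  define \<theta> where "\<theta> = (1 + \<beta>) / 2"
  have \<theta>: "\<theta> > \<beta>" "0 < \<theta>" "\<theta> < 1" unfolding \<theta>_def using \<beta> \<beta>_nonneg by auto
  have osc: "\<forall>\<^sub>F M in sequentially. \<forall>p. osc_le (\<theta> ^ k * (2 * C)) M (\<lambda>n. x n p)" for k
  proof (induction k)
    case 0
    have "\<bar>x n p - x n' p\<bar> \<le> 2 * C" for n n' p
      using C(2)[of n p] C(2)[of n' p] by linarith
    then show ?case unfolding osc_le_def by simp
  next
    case (Suc k)
    have "\<forall>\<^sub>F M in sequentially. \<forall>p.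
        osc_le (\<beta> * (\<theta> ^ k * (2 * C)) + (\<theta> - \<beta>) * (\<theta> ^ k * (2 * C))) M (\<lambda>n. x n p)"
      using \<theta> C(1) by (intro osc_le_contract[OF Suc]) auto
    then show ?case by (simp add: algebra_simps)
  qed
  have "\<forall>\<^sub>F M in sequentially. osc_le \<epsilon> M (\<lambda>n. x n p)" if "\<epsilon> > 0" for \<epsilon>
  proof -
    have "(\<lambda>k. \<theta> ^ k * (2 * C)) \<longlonglongrightarrow> 0 * (2 * C)"
      using \<theta> by (intro tendsto_mult LIMSEQ_power_zero tendsto_const) auto
    then have "\<forall>\<^sub>F k in sequentially. \<theta> ^ k * (2 * C) < \<epsilon>"
      by (rule order_tendstoD) (use that in simp)
    then obtain k where "\<theta> ^ k * (2 * C) < \<epsilon>" by (auto simp: eventually_sequentially)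
    with osc[of k] show ?thesis
      by (auto elim!: eventually_mono simp: osc_le_def) (meson less_imp_le order_trans)
  qed
  then show ?thesis
    unfolding asymp_periodic_iff_Cauchy[OF N] x_def osc_le_def by blast
qed

end

section \<open>Resolvents of matrix sequences\<close>

lemma matrix_mult_sum_right: "A ** (\<Sum>i\<in>I. f i) = (\<Sum>i\<in>I. A ** f i)" for A :: "real^'n^'m"
  by (induction I rule: infinite_finite_induct) (auto simp: matrix_add_ldistrib)

lemma matrix_mult_sum_left: "(\<Sum>i\<in>I. f i) ** A = (\<Sum>i\<in>I. f i ** A)" for A :: "real^'n^'m"
  by (induction I rule: infinite_finite_induct) (auto simp: matrix_matrix_mult_def vec_eq_iff distrib_right sum.distrib)

text \<open>
  Inserting the induction hypothesis into the recursion yields the sum of all triple products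
  \<open>U(a) Z(i) U(b)\<close> with \<open>a + i + b = n - 1\<close>, which can be collected from either side.
\<close>

lemma resolvent_commute:
  fixes U Z :: "nat \<Rightarrow> real^'d^'d"
  assumes Z_Suc: "\<And>n. Z (Suc n) = (\<Sum>j\<le>n. U (n - j) ** Z j)" and Z_0: "Z 0 = mat 1"
  shows "Z (Suc n) = (\<Sum>j\<le>n. Z j ** U (n - j))"
proof (induction n rule: less_induct)
  case (less n)
  have peel: "(\<Sum>j\<le>n. f j) = f 0 + (\<Sum>k<n. f (Suc k))" for f :: "nat \<Rightarrow> real^'d^'d"
    by (simp add: lessThan_Suc_atMost[symmetric] sum.lessThan_Suc_shift del: sum.lessThan_Suc)
  have "Z (Suc n) = U n + (\<Sum>k<n. U (n - Suc k) ** Z (Suc k))"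
    unfolding Z_Suc[of n] by (subst peel) (simp add: Z_0)
  also have "(\<Sum>k<n. U (n - Suc k) ** Z (Suc k)) =
      (\<Sum>k<n. \<Sum>i\<le>k. U (n - Suc k) ** Z i ** U (k - i))"
    by (intro sum.cong refl) (simp add: less.IH matrix_mult_sum_right matrix_mul_assoc)
  also have "\<dots> = (\<Sum>(k, i)\<in>(SIGMA k:{..<n}. {..k}). U (n - Suc k) ** Z i ** U (k - i))"
    by (simp add: sum.Sigma)
  \<comment> \<open>Exchanging the indices of the two outer factors is an involution of the index set.\<close>
  also have "\<dots> = (\<Sum>(k, i)\<in>(SIGMA k:{..<n}. {..k}). U (k - i) ** Z i ** U (n - Suc k))"
    by (rule sum.reindex_bij_witness[of _ "\<lambda>(k, i). (n - Suc k + i, i)" "\<lambda>(k, i). (n - Suc k + i, i)"])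
      auto
  also have "\<dots> = (\<Sum>k<n. \<Sum>i\<le>k. U (k - i) ** Z i ** U (n - Suc k))"
    by (simp add: sum.Sigma)
  also have "\<dots> = (\<Sum>k<n. Z (Suc k) ** U (n - Suc k))"
    by (simp add: Z_Suc matrix_mult_sum_left)
  also have "U n + \<dots> = (\<Sum>j\<le>n. Z j ** U (n - j))"
    by (subst peel) (simp add: Z_0)
  finally show ?case .
qed

lemma sum_convolution_le:
  fixes a b :: "nat \<Rightarrow> real"
  assumes "\<And>i. a i \<ge> 0" "\<And>i. b i \<ge> 0"
  shows "(\<Sum>k\<le>n. \<Sum>j\<le>k. a (k - j) * b j) \<le> (\<Sum>i\<le>n. a i) * (\<Sum>j\<le>n. b j)"
proof -
  have "(\<Sum>k\<le>n. \<Sum>j\<le>k. a (k - j) * b j) = (\<Sum>(j, i)\<in>{(j, i). j + i \<le> n}. a i * b j)"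
    by (rule sum.triangle_reindex_eq[symmetric])
  also have "\<dots> \<le> (\<Sum>(j, i)\<in>{..n} \<times> {..n}. a i * b j)"
    using assms by (intro sum_mono2) auto
  also have "\<dots> = (\<Sum>i\<le>n. a i) * (\<Sum>j\<le>n. b j)"
  proof -
    have "(\<Sum>i\<le>n. a i) * (\<Sum>j\<le>n. b j) = (\<Sum>j\<le>n. \<Sum>i\<le>n. b j * a i)"
      by (subst mult.commute) (rule sum_product)
    then show ?thesis by (simp add: sum.cartesian_product[symmetric] mult.commute)
  qed
  finally show ?thesis .
qed

text \<open>
  If \<open>S\<close> bounds the weighted row sums of \<open>Z(0), \<dots>, Z(n)\<close>, then the recursion bounds those
  of \<open>Z(0), \<dots>, Z(n+1)\<close> by \<open>1 + v S\<close>; the fixed point of this map is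
  \<open>S = 1 / (1 - v)\<close>.  Working with partial sums avoids all questions of convergence.
\<close>

lemma resolvent_sum_bound:
  fixes U Z :: "nat \<Rightarrow> real^'d^'d"
  assumes Z_Suc: "\<And>n. Z (Suc n) = (\<Sum>j\<le>n. U (n - j) ** Z j)" and Z_0: "Z 0 = mat 1"
    and t: "t \<ge> 0" and v: "v < 1"
    and U: "\<And>n p. (\<Sum>k<n. \<Sum>q\<in>UNIV. t ^ Suc k * \<bar>U k $ p $ q\<bar>) \<le> v"
  shows "(\<Sum>j=1..n. \<Sum>q\<in>UNIV. t ^ j * \<bar>Z j $ p $ q\<bar>) \<le> v / (1 - v)"
proof -
  define z where "z j p = (\<Sum>q\<in>UNIV. t ^ j * \<bar>Z j $ p $ q\<bar>)" for j p
  define u where "u k p s = t ^ Suc k * \<bar>U k $ p $ s\<bar>" for k p s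
  have nonneg: "z j p \<ge> 0" "u k p s \<ge> 0" for j k p s
    unfolding z_def u_def using t by (auto intro: sum_nonneg)
  have v0: "v \<ge> 0" using U[of _ 0] by simp
  have z_0: "z 0 p = 1" for p
    by (simp add: z_def Z_0 mat_def if_distrib[of abs] cong: if_cong)
  have z_Suc: "z (Suc k) p \<le> (\<Sum>j\<le>k. \<Sum>s\<in>UNIV. u (k - j) p s * z j s)" for k p
  proof -
    have "z (Suc k) p = (\<Sum>q\<in>UNIV. t ^ Suc k * \<bar>\<Sum>j\<le>k. \<Sum>s\<in>UNIV. U (k - j) $ p $ s * Z j $ s $ q\<bar>)"
      unfolding z_def Z_Suc by (simp add: matrix_matrix_mult_def)
    also have "\<dots> \<le> (\<Sum>q\<in>UNIV. t ^ Suc k * (\<Sum>j\<le>k. \<Sum>s\<in>UNIV. \<bar>U (k - j) $ p $ s\<bar> * \<bar>Z j $ s $ q\<bar>))"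
      using t unfolding abs_mult[symmetric]
      by (intro sum_mono mult_left_mono order_trans[OF sum_abs]) auto
    also have "\<dots> = (\<Sum>q\<in>UNIV. \<Sum>j\<le>k. \<Sum>s\<in>UNIV. u (k - j) p s * (t ^ j * \<bar>Z j $ s $ q\<bar>))"
      unfolding sum_distrib_left
    proof (intro sum.cong refl)
      fix j s q assume "j \<in> {..k}"
      then have *: "t ^ k = t ^ (k - j) * t ^ j" by (simp add: power_add[symmetric])
      show "t ^ Suc k * (\<bar>U (k - j) $ p $ s\<bar> * \<bar>Z j $ s $ q\<bar>) =
          u (k - j) p s * (t ^ j * \<bar>Z j $ s $ q\<bar>)"
        unfolding u_def by (simp add: * mult_ac)
    qed
    also have "\<dots> = (\<Sum>j\<le>k. \<Sum>q\<in>UNIV. \<Sum>s\<in>UNIV. u (k - j) p s * (t ^ j * \<bar>Z j $ s $ q\<bar>))"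
      by (rule sum.swap)
    also have "\<dots> = (\<Sum>j\<le>k. \<Sum>s\<in>UNIV. \<Sum>q\<in>UNIV. u (k - j) p s * (t ^ j * \<bar>Z j $ s $ q\<bar>))"
      by (intro sum.cong refl sum.swap)
    also have "\<dots> = (\<Sum>j\<le>k. \<Sum>s\<in>UNIV. u (k - j) p s * z j s)"
      by (simp add: z_def sum_distrib_left)
    finally show ?thesis .
  qed
  have step: "(\<Sum>j\<le>Suc n. z j p) \<le> 1 / (1 - v)" if IH: "\<And>s. (\<Sum>j\<le>n. z j s) \<le> 1 / (1 - v)" for n p
  proof -
    have "(\<Sum>j\<le>Suc n. z j p) = 1 + (\<Sum>k\<le>n. z (Suc k) p)"
      by (simp add: sum.atMost_Suc_shift z_0 del: sum.atMost_Suc)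
    also have "(\<Sum>k\<le>n. z (Suc k) p) \<le> (\<Sum>k\<le>n. \<Sum>j\<le>k. \<Sum>s\<in>UNIV. u (k - j) p s * z j s)"
      by (intro sum_mono z_Suc)
    also have "\<dots> = (\<Sum>s\<in>UNIV. \<Sum>k\<le>n. \<Sum>j\<le>k. u (k - j) p s * z j s)"
      by (simp add: sum.swap[of _ UNIV])
    also have "\<dots> \<le> (\<Sum>s\<in>UNIV. (\<Sum>k\<le>n. u k p s) * (\<Sum>j\<le>n. z j s))"
      using nonneg by (intro sum_mono sum_convolution_le) auto
    also have "\<dots> \<le> (\<Sum>s\<in>UNIV. (\<Sum>k\<le>n. u k p s) * (1 / (1 - v)))"
      using nonneg by (intro sum_mono mult_left_mono IH sum_nonneg) auto
    also have "\<dots> = (\<Sum>k<Suc n. \<Sum>s\<in>UNIV. u k p s) * (1 / (1 - v))"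
      unfolding sum_distrib_right[symmetric] lessThan_Suc_atMost by (subst sum.swap) (rule refl)
    also have "\<dots> \<le> v * (1 / (1 - v))"
      using U[of p "Suc n"] v unfolding u_def by (intro mult_right_mono) auto
    finally show ?thesis using v by (simp add: field_simps)
  qed
  have "(\<Sum>j\<le>n. z j p) \<le> 1 / (1 - v)" for n p
  proof (induction n arbitrary: p)
    case 0
    show ?case using v v0 by (simp add: z_0 field_simps)
  next
    case (Suc n)
    show ?case by (rule step[OF Suc])
  qed
  from this[of p n] have "(\<Sum>j\<le>n. z j p) \<le> 1 / (1 - v)" .
  moreover have "(\<Sum>j\<le>n. z j p) = 1 + (\<Sum>j=1..n. z j p)"
    by (simp add: z_0 atMost_atLeast0 sum.atLeast_Suc_atMost)
  ultimately show ?thesis unfolding z_def using v by (simp add: field_simps)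
qed

section \<open>Inverting the resolvent\<close>

text \<open>
  For \<open>k = Nl + i\<close> with \<open>i < N\<close> one has \<open>k + 1 \<le> N(l+1)\<close>, and \<open>1 / r \<ge> 1\<close>, so the
  weights \<open>r\<^sup>-\<^sup>N\<^sup>(\<^sup>l\<^sup>+\<^sup>1\<^sup>)\<close> of the blockwise series dominate the weights \<open>r\<^sup>-\<^sup>(\<^sup>k\<^sup>+\<^sup>1\<^sup>)\<close>.
\<close>

lemma partial_sum_bound_of_residue_series:
  fixes U :: "nat \<Rightarrow> real^'d^'d"
  assumes N: "N \<ge> 1" and r: "0 < r" "r \<le> 1"
    and small: "(MAX p. \<Sum>q\<in>UNIV. \<Sum>i=0..N - 1. \<Sum>l. ennreal (r powi (- int (N * (l + 1))) * \<bar>U (N * l + i) $ p $ q\<bar>))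
           < ennreal c"
  obtains v where "v < c" "\<And>n p. (\<Sum>k<n. \<Sum>q\<in>UNIV. (1 / r) ^ Suc k * \<bar>U k $ p $ q\<bar>) \<le> v"
proof -
  define F where "F p = (\<Sum>q\<in>UNIV. \<Sum>i=0..N - 1. \<Sum>l. ennreal (r powi (- int (N * (l + 1))) * \<bar>U (N * l + i) $ p $ q\<bar>))" for p
  have F_less: "(MAX p. F p) < ennreal c" using small unfolding F_def .
  then obtain v where v: "v \<ge> 0" "(MAX p. F p) = ennreal v"
    by (metis ennreal_cases ennreal_less_top not_less_iff_gr_or_eq)
  show ?thesis
  proof
    show "v < c" using F_less v by (simp add: ennreal_less_iff)
    fix n p
    define f where "f k = (\<Sum>q\<in>UNIV. (1 / r) ^ Suc k * \<bar>U k $ p $ q\<bar>)" for k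
    have f_nonneg: "f k \<ge> 0" for k unfolding f_def using r by (intro sum_nonneg) auto
    define w where "w l i q = r powi (- int (N * (l + 1))) * \<bar>U (N * l + i) $ p $ q\<bar>" for l i q
    have w_nonneg: "w l i q \<ge> 0" for l i q unfolding w_def using r by simp
    have f_le: "f (l * N + i) \<le> (\<Sum>q\<in>UNIV. w l i q)" if "i < N" for l i
      unfolding f_def w_def
    proof (intro sum_mono)
      fix q
      have "(1 / r) ^ Suc (l * N + i) \<le> (1 / r) ^ (N * (l + 1))"
        using that r by (intro power_increasing) (auto simp: mult.commute)
      also have "\<dots> = r powi (- int (N * (l + 1)))"
        by (simp only: power_int_minus power_int_of_nat power_one_over inverse_eq_divide)
      finally show "(1 / r) ^ Suc (l * N + i) * \<bar>U (l * N + i) $ p $ q\<bar> \<le>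
          r powi (- int (N * (l + 1))) * \<bar>U (N * l + i) $ p $ q\<bar>"
        unfolding mult.commute[of l N] by (rule mult_right_mono) simp
    qed
    have "n \<le> n * N" using N by (cases N) auto
    then have "(\<Sum>k<n. f k) \<le> (\<Sum>k<n * N. f k)"
      using f_nonneg by (intro sum_mono2) auto
    also have "\<dots> = (\<Sum>l<n. \<Sum>i<N. f (l * N + i))"
    proof -
      have "sum f {l * N..<l * N + N} = (\<Sum>i<N. f (l * N + i))" for l
        using sum.shift_bounds_nat_ivl[of f 0 "l * N" N] by (simp add: add.commute atLeast0LessThan)
      then show ?thesis by (simp add: sum.nat_group[symmetric])
    qed
    also have "\<dots> \<le> (\<Sum>l<n. \<Sum>i<N. \<Sum>q\<in>UNIV. w l i q)"
      by (intro sum_mono f_le) auto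
    also have "\<dots> = (\<Sum>q\<in>UNIV. \<Sum>i<N. \<Sum>l<n. w l i q)"
      by (simp add: sum.swap[of _ UNIV] sum.swap[of _ "{..<N}" "{..<n}"])
    finally have "ennreal (\<Sum>k<n. f k) \<le> ennreal (\<Sum>q\<in>UNIV. \<Sum>i<N. \<Sum>l<n. w l i q)"
      by (rule ennreal_leI)
    also have "\<dots> = (\<Sum>q\<in>UNIV. \<Sum>i<N. \<Sum>l<n. ennreal (w l i q))"
      using w_nonneg by (simp add: sum_nonneg)
    also have "\<dots> \<le> (\<Sum>q\<in>UNIV. \<Sum>i<N. \<Sum>l. ennreal (w l i q))"
      by (intro sum_mono sum_le_suminf) auto
    also have "\<dots> = F p"
    proof -
      have "{..<N} = {0..N - 1}" using N by auto
      then show ?thesis unfolding F_def w_def by simp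
    qed
    also have "\<dots> \<le> (MAX p. F p)" by (intro Max_ge) auto
    finally show "(\<Sum>k<n. \<Sum>q\<in>UNIV. (1 / r) ^ Suc k * \<bar>U k $ p $ q\<bar>) \<le> v"
      using v unfolding f_def[symmetric] by (simp add: ennreal_le_iff)
  qed
qed

theorem theorem3p7:
  fixes N :: nat and r :: real and \<phi> :: "nat \<Rightarrow> real"
    and U Z :: "nat \<Rightarrow> real^'d^'d"
  assumes "N \<ge> 1" and "0 < r" and "r \<le> 1"
    and "\<And>n. Z (n + 1) = (\<Sum>j=0..n. U (n - j) ** Z j)" and "Z 0 = mat 1"
    and "Z \<in> WP_class r N" and "weight_function r N \<phi> Z"
    and "(MAX p. \<Sum>q\<in>UNIV. \<Sum>i=0..N - 1. \<Sum>l. ennreal (r powi (- int (N * (l + 1))) * \<bar>U (N * l + i) $ p $ q\<bar>))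
           < ennreal (1 / (1 + r powi (- int N)))"
  shows "U \<in> WP_class r N \<and> weight_function r N \<phi> U"
proof -
  have Z_Suc: "Z (Suc n) = (\<Sum>j\<le>n. U (n - j) ** Z j)" for n
    using assms(4)[of n] by (simp add: atMost_atLeast0)
  have \<phi>: "\<phi> \<in> W_class r" using assms(7) by (simp add: weight_function_def)
  have Z_ap: "asymp_periodic N (\<lambda>n. Z n $ p $ q / \<phi> n)" for p q
    using assms(7) weight_function_iff_asymp_periodic[OF \<phi> assms(2,1)] by blast
  obtain v where v: "v < 1 / (1 + r powi (- int N))"
    and U_sum: "\<And>n p. (\<Sum>k<n. \<Sum>q\<in>UNIV. (1 / r) ^ Suc k * \<bar>U k $ p $ q\<bar>) \<le> v"
    using partial_sum_bound_of_residue_series[OF assms(1-3,8)] by blast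
  have "(1 :: real) \<le> r powi (- int N)"
    using assms(2,3) by (simp add: power_int_minus one_le_inverse_iff power_le_one)
  then have "1 / (1 + r powi (- int N)) \<le> 1 / 2" by (intro divide_left_mono) auto
  with v have v_half: "v < 1 / 2" by simp
  then have Z_sum: "(\<Sum>j=1..n. \<Sum>s\<in>UNIV. (1 / r) ^ j * \<bar>Z j $ p $ s\<bar>) \<le> v / (1 - v)" for n p
    using assms(2) by (intro resolvent_sum_bound[OF Z_Suc assms(5) _ _ U_sum]) auto
  have U_eq: "U n = Z (Suc n) - (\<Sum>j=1..n. Z j ** U (n - j))" for n
    unfolding resolvent_commute[OF Z_Suc assms(5)]
    by (simp add: assms(5) atMost_atLeast0 sum.atLeast_Suc_atMost)
  have U_ap: "asymp_periodic N (\<lambda>n. U n $ p $ q / \<phi> n)" for p q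
  proof -
    \<comment> \<open>The Volterra equation holds for each column of \<open>U\<close> separately.\<close>
    interpret subexponential_volterra \<phi> r N "\<lambda>n p. Z (Suc n) $ p $ q" "\<lambda>n p. U n $ p $ q"
      "\<lambda>j p s. - Z j $ p $ s" "v / (1 - v)"
    proof
      show "U n $ p $ q = Z (Suc n) $ p $ q + (\<Sum>j=1..n. \<Sum>s\<in>UNIV. - Z j $ p $ s * U (n - j) $ s $ q)" for n p
        by (subst U_eq) (simp add: matrix_matrix_mult_def sum_negf)
      show "asymp_periodic N (\<lambda>n. Z (Suc n) $ p $ q / \<phi> n)" for p
      proof -
        have *: "Z (Suc n) $ p $ q / \<phi> n = Z (n + 1) $ p $ q / \<phi> (n + 1) * (\<phi> (n + 1) / \<phi> n)" for n
          using W_class_pos[OF \<phi>, of "n + 1"] by simp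
        show ?thesis
          unfolding *
          by (intro asymp_periodic_mult asymp_periodic_shift[OF assms(1) Z_ap]
              asymp_periodic_tendsto[OF assms(1) W_class_ratio_shift[OF \<phi> assms(2)]])
      qed
      show "asymp_periodic N (\<lambda>n. - Z n $ p $ s / \<phi> n)" for p s
        using asymp_periodic_mult[OF asymp_periodic_const[of N "-1"] Z_ap[of p s]] by simp
      show "(\<Sum>j=1..n. \<Sum>s\<in>UNIV. \<bar>- Z j $ p $ s\<bar> * (1 / r) ^ j) \<le> v / (1 - v)" for n p
        using Z_sum[of p n] by (simp add: mult.commute)
      show "v / (1 - v) < 1" using v_half by (simp add: field_simps)
    qed (rule \<phi> assms(2,1))+
    show ?thesis by (rule solution_asymp_periodic)
  qed
  then have "weight_function r N \<phi> U"
    using weight_function_iff_asymp_periodic[OF \<phi> assms(2,1)] by blast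
  then show ?thesis unfolding WP_class_def by blast
qed

end
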